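(* Let $\mathcal{A}\in\mathbb{C}^{I_1\times\cdots\times I_M\times J_1\times\cdots\times J_N}$ and $\mathcal{B}\in\mathbb{C}^{J_1\times\cdots\times J_N\times K_1\times\cdots\times K_L}$. Let $\mathcal{M}\in\mathbb{C}^{I_1\times\cdots\times I_M\times I_1\times\cdots\times I_M}$, $\mathcal{N}\in\mathbb{C}^{J_1\times\cdots\times J_N\times J_1\times\cdots\times J_N}$ and $\mathcal{L}\in\mathbb{C}^{K_1\times\cdots\times K_L\times K_1\times\cdots\times K_L}$ be Hermitian positive definite tensors. Then $$(\mathcal{A}*_N\mathcal{B})^{\dagger}_{\mathcal{M}\mathcal{L}}=\mathcal{B}^{\dagger}_{\mathcal{N}\mathcal{L}}*_N\mathcal{A}^{\dagger}_{\mathcal{M}\mathcal{N}}$$ if and only if both $$(\mathcal{A}^{\dagger}_{\mathcal{M}\mathcal{N}}*_M\mathcal{A}*_N\mathcal{B}*_L\mathcal{B}^{\#}_{\mathcal{N}\mathcal{L}})^{\#}_{\mathcal{N}\mathcal{N}}=\mathcal{A}^{\dagger}_{\mathcal{M}\mathcal{N}}*_M\mathcal{A}*_N\mathcal{B}*_L\mathcal{B}^{\#}_{\mathcal{N}\mathcal{L}},$$ $$(\mathcal{A}^{\#}_{\mathcal{M}\mathcal{N}}*_M\mathcal{A}*_N\mathcal{B}*_L\mathcal{B}^{\dagger}_{\mathcal{N}\mathcal{L}})^{\#}_{\mathcal{N}\mathcal{N}}=\mathcal{A}^{\#}_{\mathcal{M}\mathcal{N}}*_M\mathcal{A}*_N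\mathcal{B}*_L\mathcal{B}^{\dagger}_{\mathcal{N}\mathcal{L}}.$$
   Context: For $\mathcal{A}\in\mathbb{C}^{I_1\times\cdots\times I_M\times J_1\times\cdots\times J_N}$ and $\mathcal{B}\in\mathbb{C}^{J_1\times\cdots\times J_N\times K_1\times\cdots\times K_L}$ the Einstein product $*_N$ (contracting $N$ indices) is $(\mathcal{A}*_N\mathcal{B})_{i_1\cdots i_Mk_1\cdots k_L}=\sum_{j_1,\dots,j_N}a_{i_1\cdots i_Mj_1\cdots j_N}b_{j_1\cdots j_Nk_1\cdots k_L}$; $*_M,*_L,*_K$ are defined likewise. The conjugate transpose is $(\mathcal{A}^H)_{j_1\cdots j_Ni_1\cdots i_M}=\overline{a_{i_1\cdots i_Mj_1\cdots j_N}}$. In $\mathbb{C}^{I_1\times\cdots\times I_K\times I_1\times\cdots\times I_K}$: the identity tensor $\mathcal{I}$ has entries $\prod_k\delta_{i_kj_k}$; $\mathcal{U}$ is unitary if $\mathcal{U}*_K\mathcal{U}^H=\mathcal{U}^H*_K\mathcal{U}=\mathcal{I}$; $\mathcal{D}$ is diagonal if $d_{i_1\cdots i_Kj_1\cdots j_K}=0$ whenever $(i_1,\dots,i_K)\ne(j_1,\dots,j_K)$; $\mathcal{P}$ is Hermitian positive definite if $\mathcal{P}=\mathcal{U}*_K\mathcal{D}*_K\mathcal{U}^H$ with $\mathcal{U}$ unitary and $\mathcal{D}$ diagonal with positive diagonal entries; $\mathcal{P}^{-1}$ is the inverse with respect to $*_K$. For any $\mathcal{A}\in\mathbb{C}^{I_1\times\cdots\times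 I_M\times J_1\times\cdots\times J_N}$ and Hermitian positive definite $\mathcal{S}\in\mathbb{C}^{I_1\times\cdots\times I_M\times I_1\times\cdots\times I_M}$, $\mathcal{T}\in\mathbb{C}^{J_1\times\cdots\times J_N\times J_1\times\cdots\times J_N}$: the weighted conjugate transpose is $\mathcal{A}^{\#}_{\mathcal{S}\mathcal{T}}=\mathcal{T}^{-1}*_N\mathcal{A}^H*_M\mathcal{S}$, and the weighted Moore--Penrose inverse $\mathcal{A}^{\dagger}_{\mathcal{S}\mathcal{T}}$ is the unique $\mathcal{X}\in\mathbb{C}^{J_1\times\cdots\times J_N\times I_1\times\cdots\times I_M}$ satisfying $\mathcal{A}*_N\mathcal{X}*_M\mathcal{A}=\mathcal{A}$, $\mathcal{X}*_M\mathcal{A}*_N\mathcal{X}=\mathcal{X}$, $(\mathcal{S}*_M\mathcal{A}*_N\mathcal{X})^H=\mathcal{S}*_M\mathcal{A}*_N\mathcal{X}$, $(\mathcal{T}*_N\mathcal{X}*_M\mathcal{A})^H=\mathcal{T}*_N\mathcal{X}*_M\mathcal{A}$. *)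

theory Defs
  imports Complex_Main
begin

text \<open>
  A complex tensor carries its list of dimensions \<open>[I\<^sub>1, \<dots>, I\<^sub>M]\<close> together with its entries,
  indexed by multi-indices \<open>[i\<^sub>1, \<dots>, i\<^sub>M]\<close>. Indices are counted from 0, i.e. \<open>i\<^sub>k < I\<^sub>k\<close>.
  Entries outside the index range are fixed to be 0, so that equality of tensors is equality of
  the dimensions and of all entries.
\<close>

definition multi_indices :: "nat list \<Rightarrow> nat list set" where
  "multi_indices ds = {ix. list_all2 (<) ix ds}"

typedef ctensor =
  "{(ds :: nat list, a :: nat list \<Rightarrow> complex). \<forall>ix. ix \<notin> multi_indices ds \<longrightarrow> a ix = 0}"
  by (rule exI[of _ "([], \<lambda>_. 0)"]) simp

setup_lifting type_definition_ctensor

lift_definition dims :: "ctensor \<Rightarrow> nat list" is fst .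

lift_definition entry :: "ctensor \<Rightarrow> nat list \<Rightarrow> complex" is snd .

lift_definition mk_tensor :: "nat list \<Rightarrow> (nat list \<Rightarrow> complex) \<Rightarrow> ctensor" is
  "\<lambda>ds a. (ds, \<lambda>ix. if ix \<in> multi_indices ds then a ix else 0)"
  by simp

definition tensors :: "nat list \<Rightarrow> ctensor set" where
  "tensors ds = {A. dims A = ds}"

lemma dims_mk_tensor [simp]: "dims (mk_tensor ds a) = ds"
  by transfer simp

lemma entry_mk_tensor:
  "entry (mk_tensor ds a) ix = (if ix \<in> multi_indices ds then a ix else 0)"
  by transfer simp

lemma ctensor_eqI:
  assumes "dims A = dims B" and "\<And>ix. ix \<in> multi_indices (dims A) \<Longrightarrow> entry A ix = entry B ix"
  shows "A = B"
  using assms by transfer (auto simp: fun_eq_iff, metis)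

text \<open>
  The Einstein product contracts the last \<open>N\<close> indices of \<open>A\<close> with the first \<open>N\<close> indices of \<open>B\<close>.
  It is meaningful when \<open>A\<close> has dimensions \<open>Is @ Js\<close> and \<open>B\<close> has dimensions \<open>Js @ Ks\<close> with
  \<open>length Js = N\<close>.
\<close>

definition einstein_prod :: "ctensor \<Rightarrow> nat \<Rightarrow> ctensor \<Rightarrow> ctensor"
    ("(_ \<star>\<^bsub>_\<^esub>/ _)" [70, 0, 71] 70) where
  "A \<star>\<^bsub>N\<^esub> B =
    (let M = length (dims A) - N;
         Is = take M (dims A); Js = drop M (dims A); Ks = drop N (dims B)
     in mk_tensor (Is @ Ks)
          (\<lambda>ix. \<Sum>js\<in>multi_indices Js. entry A (take M ix @ js) * entry B (js @ drop M ix)))"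

text \<open>
  \<open>A\<^sup>H\<close> depends on how the indices of \<open>A\<close> are split into two groups; the first argument is the
  length of the first group.
\<close>

definition conj_transpose :: "nat \<Rightarrow> ctensor \<Rightarrow> ctensor" where
  "conj_transpose M A =
    (let Is = take M (dims A); Js = drop M (dims A); N = length Js
     in mk_tensor (Js @ Is) (\<lambda>ix. cnj (entry A (drop N ix @ take N ix))))"

definition identity_tensor :: "nat list \<Rightarrow> ctensor" where
  "identity_tensor Is =
    mk_tensor (Is @ Is) (\<lambda>ix. \<Prod>k<length Is. of_bool (ix ! k = ix ! (length Is + k)))"

definition unitary_tensor :: "nat list \<Rightarrow> ctensor \<Rightarrow> bool" where
  "unitary_tensor Is U \<longleftrightarrow> U \<in> tensors (Is @ Is) \<and>
    (let K = length Is in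
       U \<star>\<^bsub>K\<^esub> conj_transpose K U = identity_tensor Is \<and>
       conj_transpose K U \<star>\<^bsub>K\<^esub> U = identity_tensor Is)"

definition diagonal_tensor :: "nat list \<Rightarrow> ctensor \<Rightarrow> bool" where
  "diagonal_tensor Is D \<longleftrightarrow> D \<in> tensors (Is @ Is) \<and>
    (\<forall>is\<in>multi_indices Is. \<forall>js\<in>multi_indices Is. is \<noteq> js \<longrightarrow> entry D (is @ js) = 0)"

definition hermitian_pos_def :: "nat list \<Rightarrow> ctensor \<Rightarrow> bool" where
  "hermitian_pos_def Is P \<longleftrightarrow>
    (\<exists>U D. unitary_tensor Is U \<and> diagonal_tensor Is D \<and>
       (\<forall>is\<in>multi_indices Is. \<exists>r>0. entry D (is @ is) = complex_of_real r) \<and>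
       P = U \<star>\<^bsub>length Is\<^esub> D \<star>\<^bsub>length Is\<^esub> conj_transpose (length Is) U)"

definition inverse_tensor :: "nat \<Rightarrow> ctensor \<Rightarrow> ctensor" where
  "inverse_tensor K P =
    (let Is = take K (dims P) in
     THE Q. Q \<in> tensors (Is @ Is) \<and>
       P \<star>\<^bsub>K\<^esub> Q = identity_tensor Is \<and> Q \<star>\<^bsub>K\<^esub> P = identity_tensor Is)"

text \<open>
  In the weighted notions below, \<open>A\<close> has dimensions \<open>Is @ Js\<close> with \<open>length Is = M\<close> and
  \<open>length Js = N\<close>, and \<open>S\<close>, \<open>T\<close> have dimensions \<open>Is @ Is\<close> and \<open>Js @ Js\<close>.
\<close>

definition weighted_conj_transpose ::
    "nat \<Rightarrow> nat \<Rightarrow> ctensor \<Rightarrow> ctensor \<Rightarrow> ctensor \<Rightarrow> ctensor" where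
  "weighted_conj_transpose M N S T A =
     inverse_tensor N T \<star>\<^bsub>N\<^esub> conj_transpose M A \<star>\<^bsub>M\<^esub> S"

definition is_weighted_pinv ::
    "nat \<Rightarrow> nat \<Rightarrow> ctensor \<Rightarrow> ctensor \<Rightarrow> ctensor \<Rightarrow> ctensor \<Rightarrow> bool" where
  "is_weighted_pinv M N S T A X \<longleftrightarrow>
     X \<in> tensors (drop M (dims A) @ take M (dims A)) \<and>
     A \<star>\<^bsub>N\<^esub> X \<star>\<^bsub>M\<^esub> A = A \<and>
     X \<star>\<^bsub>M\<^esub> A \<star>\<^bsub>N\<^esub> X = X \<and>
     conj_transpose M (S \<star>\<^bsub>M\<^esub> A \<star>\<^bsub>N\<^esub> X) = S \<star>\<^bsub>M\<^esub> A \<star>\<^bsub>N\<^esub> X \<and>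
     conj_transpose N (T \<star>\<^bsub>N\<^esub> X \<star>\<^bsub>M\<^esub> A) = T \<star>\<^bsub>N\<^esub> X \<star>\<^bsub>M\<^esub> A"

definition weighted_pinv ::
    "nat \<Rightarrow> nat \<Rightarrow> ctensor \<Rightarrow> ctensor \<Rightarrow> ctensor \<Rightarrow> ctensor" where
  "weighted_pinv M N S T A = (THE X. is_weighted_pinv M N S T A X)"

end

theory Submission
  imports Defs "HOL-Library.Function_Algebras"
begin

text \<open>
  Tensors with their indices split into two groups are finitely supported matrices over
  multi-indices, and the Einstein product is matrix multiplication. The finitely supported
  matrices over one index type form a non-unital ring with involution that is proper
  (\<open>x\<^sup>* x = 0\<close> only for \<open>x = 0\<close>) and von Neumann regular; these two properties give
  Moore--Penrose inverses and Greville's reverse order law: with \<open>p = a\<^sup>\<dagger>a\<close> and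
  \<open>q = bb\<^sup>\<dagger>\<close>, the law holds iff \<open>p\<close> commutes with \<open>bb\<^sup>*\<close> and \<open>q\<close> commutes
  with \<open>a\<^sup>*a\<close>. The weights are removed by the substitution \<open>a \<mapsto> S\<^bsup>1/2\<^esup> a T\<^bsup>-1/2\<^esup>\<close>.
\<close>

subsection \<open>Greville's reverse order law in rings with involution\<close>

class regular_star_ring = ring +
  fixes adj :: "'a \<Rightarrow> 'a"
  assumes adj_adj [simp]: "adj (adj x) = x"
    and adj_mult: "adj (x * y) = adj y * adj x"
    and adj_diff: "adj (x - y) = adj x - adj y"
    and adj_mult_self_eq_0D: "adj x * x = 0 \<Longrightarrow> x = 0"
    and von_Neumann_regular: "\<exists>g. x * g * x = x"
begin

section \<open>Existence and uniqueness of Moore-Penrose inverses\<close>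

definition penrose :: "'a \<Rightarrow> 'a \<Rightarrow> bool" where
  "penrose a x \<longleftrightarrow> a * x * a = a \<and> x * a * x = x \<and> adj (a * x) = a * x \<and> adj (x * a) = x * a"

lemma penrose_adj: "penrose a x \<Longrightarrow> penrose (adj a) (adj x)"
  unfolding penrose_def by (metis adj_mult mult_assoc)

text \<open>The self-adjoint idempotents \<open>a * x\<close> and \<open>a * y\<close> absorb each
  other, and taking adjoints makes them equal; likewise \<open>x * a = y * a\<close>. Then
  \<open>x = x * a * x = x * a * y = y * a * y = y\<close>.\<close>

lemma penrose_unique:
  assumes "penrose a x" and "penrose a y"
  shows "x = y"
proof -
  have x: "a * x * a = a" "x * a * x = x" "adj (a * x) = a * x" "adj (x * a) = x * a"
    and y: "a * y * a = a" "y * a * y = y" "adj (a * y) = a * y" "adj (y * a) = y * a"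
    using assms by (auto simp: penrose_def)
  have "a * x = adj (a * y * (a * x))"
    using x(3) y(1) by (simp flip: mult_assoc)
  also have "\<dots> = a * x * (a * y)"
    using x(3) y(3) by (simp add: adj_mult)
  also have "\<dots> = a * y"
    using x(1) by (simp flip: mult_assoc)
  finally have ax: "a * x = a * y" .
  have "x * a = adj (x * a * (y * a))"
    using x(4) y(1) by (simp add: mult_assoc)
  also have "\<dots> = y * a * (x * a)"
    using x(4) y(4) by (simp add: adj_mult)
  also have "\<dots> = y * a"
    using x(1) by (simp add: mult_assoc)
  finally have xa: "x * a = y * a" .
  show ?thesis
    using x(2) y(2) ax xa by (metis mult_assoc)
qed

text \<open>Normal equations: if \<open>g\<close> is an inner inverse of \<open>adj a * a\<close>,
  then \<open>g * adj a\<close> is a suitable \<open>x\<close>.\<close>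

lemma least_squares_inverse:
  obtains x where "a * x * a = a" and "adj (a * x) = a * x"
proof -
  obtain g where g: "(adj a * a) * g * (adj a * a) = adj a * a"
    using von_Neumann_regular by blast
  \<comment> \<open>The defect \<open>z\<close> is annihilated by \<open>adj a\<close> from the
    left, and \<open>adj z\<close> ends in the factor \<open>adj a\<close>, so properness forces
    \<open>z = 0\<close>.\<close>
  define z where "z = a * g * adj a * a - a"
  have "adj a * z = 0"
    using g by (simp add: z_def right_diff_distrib mult_assoc)
  moreover have "adj z = adj (g * adj a * a) * adj a - adj a"
    by (simp add: z_def adj_diff adj_mult mult_assoc)
  ultimately have "adj z * z = 0"
    by (simp add: left_diff_distrib mult_assoc)
  then have 1: "a * g * adj a * a = a"
    unfolding z_def by (metis adj_mult_self_eq_0D right_minus_eq)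
  then have 2: "adj a * a * adj g * adj a = adj a"
    by (metis adj_mult adj_adj mult_assoc)
  \<comment> \<open>Expanding the trailing \<open>adj a\<close> by 2 and contracting by 1 replaces
    \<open>g\<close> by \<open>adj g\<close>, so \<open>a * g * adj a\<close> is
    self-adjoint.\<close>
  have "a * g * adj a = a * g * (adj a * a * adj g * adj a)"
    by (simp add: 2)
  also have "\<dots> = (a * g * adj a * a) * adj g * adj a"
    by (simp add: mult_assoc)
  also have "\<dots> = adj (a * g * adj a)"
    by (simp only: 1) (simp add: adj_mult mult_assoc)
  finally show ?thesis
    using that[of "g * adj a"] 1 by (simp add: mult_assoc)
qed

text \<open>An inner inverse \<open>x\<close> with \<open>a * x\<close> self-adjoint and an inner
  inverse \<open>y\<close> with \<open>y * a\<close> self-adjoint combine to the Moore-Penrose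
  inverse \<open>y * a * x\<close>.\<close>

lemma penrose_exists: "\<exists>x. penrose a x"
proof -
  obtain x where x: "a * x * a = a" "adj (a * x) = a * x"
    using least_squares_inverse .
  \<comment> \<open>Least squares for \<open>adj a\<close>: the adjoint of \<open>w\<close> is an
    inner inverse of \<open>a\<close> whose product on the other side is self-adjoint.\<close>
  obtain w where w: "adj a * w * adj a = adj a" "adj (adj a * w) = adj a * w"
    using least_squares_inverse .
  define y where "y = adj w"
  have y: "a * y * a = a" "adj (y * a) = y * a"
    using w unfolding y_def by (metis adj_adj adj_mult mult_assoc)+
  have ax: "a * (y * a * x) = a * x" and ya: "y * a * x * a = y * a"
    using x(1) y(1) by (metis mult_assoc)+
  have "penrose a (y * a * x)"
    unfolding penrose_def ax ya using x y by (metis ax mult_assoc)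
  then show ?thesis by blast
qed

text \<open>\<open>x = adj (x * a) * x\<close> starts with the factor \<open>adj a\<close>, which
  \<open>e\<close> fixes from the left. In a ring without unit this locates the inverse in the block
  of \<open>e\<close>.\<close>

lemma penrose_left_unit:
  assumes "penrose a x" and "a * e = a" and "adj e = e"
  shows "e * x = x"
proof -
  have "x * a * x = x" "adj (x * a) = x * a"
    using assms(1) by (auto simp: penrose_def)
  then show ?thesis
    by (metis adj_mult assms(2,3) mult_assoc)
qed

lemma penrose_right_unit:
  assumes "penrose a x" and "e * a = a" and "adj e = e"
  shows "x * e = x"
  using penrose_left_unit[OF penrose_adj[OF assms(1)], of e] assms
  by (metis adj_adj adj_mult)

section \<open>Greville's criterion for the reverse order law\<close>

text \<open>For z = (1 - p) h adj(a), written without the unit, \<open>adj z * z\<close> is the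
  difference of the two sides of \<open>c\<close>; properness gives \<open>z = 0\<close>.\<close>

lemma invariant_of_compression_eq:
  assumes p: "p * p = p" "adj p = p"
    and h: "adj h = h"
    and c: "a * h * p * h * adj a = a * h * h * adj a"
  shows "p * h * adj a = h * adj a"
proof -
  define z where "z = h * adj a - p * h * adj a"
  have "adj z * z = a * h * h * adj a - a * h * p * h * adj a
      - (a * h * p * h * adj a - a * h * (p * p) * h * adj a)"
    using p(2) h by (simp add: z_def adj_diff adj_mult algebra_simps)
  then have "adj z * z = 0"
    by (simp add: p(1) c)
  then show ?thesis
    unfolding z_def by (metis adj_mult_self_eq_0D right_minus_eq)
qed

text \<open>Necessity of the two commutation relations rests on properness, through invariance under
  \<open>p\<close> and \<open>q\<close>. For sufficiency, they first yield
  \<open>p * q = q * p\<close>, and then the four Penrose equations follow by direct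
  computation.\<close>

theorem penrose_mult_iff:
  assumes "penrose a x" and "penrose b y"
  shows "penrose (a * b) (y * x) \<longleftrightarrow>
      adj (x * a * b * adj b) = x * a * b * adj b \<and> adj (adj a * a * b * y) = adj a * a * b * y"
proof -
  have x: "a * x * a = a" "x * a * x = x" "adj (a * x) = a * x" "adj (x * a) = x * a"
    and y: "b * y * b = b" "y * b * y = y" "adj (b * y) = b * y" "adj (y * b) = y * b"
    using assms by (auto simp: penrose_def)
  define p q h g where "p = x * a" and "q = b * y" and "h = b * adj b" and "g = adj a * a"
  have p: "p * p = p" "adj p = p" and q: "q * q = q" "adj q = q"
    and h: "adj h = h" and g: "adj g = g"
    using x y by (simp_all add: p_def q_def h_def g_def adj_mult) (metis mult_assoc)+
  have ap: "a * p = a" and px: "p * x = x" and qb: "q * b = b" and yq: "y * q = y"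
    using x y by (simp_all add: p_def q_def mult_assoc)
  have pa: "p * adj a = adj a" and bq: "adj b * q = adj b"
    using ap qb p q by (metis adj_mult)+
  have pxa: "adj a * adj x = p" and qyb: "adj y * adj b = q"
    using p(2) q(2) by (simp_all add: p_def q_def adj_mult)
  have gx: "g * x = adj a"
    using x by (metis g_def adj_mult mult_assoc)
  have yh: "y * h = adj b"
    using y by (metis h_def adj_mult mult_assoc)
  have xg: "adj x * g = a" and hy: "h * adj y = b"
    using gx yh g h by (metis adj_adj adj_mult)+
  have conditions:
    "adj (x * a * b * adj b) = x * a * b * adj b \<longleftrightarrow> h * p = p * h"
    "adj (adj a * a * b * y) = adj a * a * b * y \<longleftrightarrow> q * g = g * q"
    using p(2) q(2) g h
    by (simp_all add: p_def q_def h_def g_def mult_assoc[symmetric])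
      (metis adj_adj adj_mult mult_assoc)+
  show ?thesis
    unfolding conditions
  proof
    assume "penrose (a * b) (y * x)"
    then have c: "a * b * (y * x) * (a * b) = a * b"
        "adj (a * b * (y * x)) = a * b * (y * x)"
        "adj (y * x * (a * b)) = y * x * (a * b)"
      by (auto simp: penrose_def)
    have 1: "adj b * adj a = y * p * h * adj a"
    proof -
      have "adj b * adj a = adj (a * b * (y * x * (a * b)))"
        using c(1) by (simp add: adj_mult mult_assoc)
      also have "\<dots> = y * x * (a * b) * adj (a * b)"
        using c(3) by (simp only: adj_mult[of "a * b"])
      finally show ?thesis
        by (simp add: p_def h_def adj_mult mult_assoc)
    qed
    have 2: "adj b * adj a = adj b * g * q * x"
    proof -
      have "adj b * adj a = adj (a * b * (y * x) * (a * b))"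
        using c(1) by (simp add: adj_mult)
      also have "\<dots> = adj (a * b) * (a * b * (y * x))"
        using c(2) by (simp only: adj_mult[of _ "a * b"])
      finally show ?thesis
        by (simp add: q_def g_def adj_mult mult_assoc)
    qed
    \<comment> \<open>Substituting 1 for \<open>adj b * adj a\<close> and absorbing \<open>q\<close>
      into \<open>h\<close> produces the compression equation for \<open>p\<close> and
      \<open>h\<close>.\<close>
    have "a * h * h * adj a = a * h * b * (adj b * adj a)"
      by (simp add: h_def mult_assoc)
    also have "\<dots> = a * h * q * p * h * adj a"
      unfolding 1 by (simp add: q_def mult_assoc)
    also have "h * q = h"
      by (simp add: h_def mult_assoc bq)
    then have "a * h * q * p * h * adj a = a * h * p * h * adj a"
      by (simp add: mult_assoc)
    finally have "p * h * adj a = h * adj a"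
      using invariant_of_compression_eq[OF p h] by simp
    \<comment> \<open>Right multiplication by \<open>adj x\<close> turns \<open>adj a\<close> into
      \<open>p\<close>. As \<open>p * h * p\<close> is self-adjoint, so is \<open>h * p\<close>,
      which is commutation.\<close>
    then have "p * h * p = h * p"
      using pxa by (metis mult_assoc)
    then have "h * p = p * h"
      using p h by (metis adj_mult mult_assoc)
    \<comment> \<open>The mirror argument, with \<open>q\<close>, \<open>g\<close>,
      \<open>adj b\<close> in the roles of \<open>p\<close>, \<open>h\<close>,
      \<open>a\<close>.\<close>
    have "adj b * g * g * b = adj b * adj a * a * g * b"
      by (simp add: g_def mult_assoc)
    also have "\<dots> = adj b * g * q * p * g * b"
      unfolding 2 by (simp add: p_def mult_assoc)
    also have "p * g = g"
      by (simp add: g_def pa flip: mult_assoc)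
    then have "adj b * g * q * p * g * b = adj b * g * q * g * b"
      by (simp add: mult_assoc)
    finally have "q * g * b = g * b"
      using invariant_of_compression_eq[OF q g, of "adj b"] by simp
    then have "q * g * q = g * q"
      by (metis q_def mult_assoc)
    then have "q * g = g * q"
      using q g by (metis adj_mult mult_assoc)
    with \<open>h * p = p * h\<close> show "h * p = p * h \<and> q * g = g * q" ..
  next
    assume "h * p = p * h \<and> q * g = g * q"
    then have hp: "h * p = p * h" and qg: "q * g = g * q" by auto
    have "q * h = h"
      by (simp add: h_def qb flip: mult_assoc)
    \<comment> \<open>Commutation lets \<open>p * b\<close> begin with \<open>h\<close>, which
      \<open>q\<close> fixes; hence \<open>q\<close> fixes \<open>p * b\<close>, and the projections
      \<open>p\<close> and \<open>q\<close> commute.\<close>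
    have "p * b = h * p * adj y"
      by (metis hp hy mult_assoc)
    then have "q * p * b = p * b"
      using \<open>q * h = h\<close> by (metis mult_assoc)
    then have "q * p * q = p * q"
      by (metis q_def mult_assoc)
    then have pq: "p * q = q * p"
      using p q by (metis adj_mult mult_assoc)
    have abyx: "a * b * (y * x) = a * q * x" and yxab: "y * x * (a * b) = y * p * b"
      by (simp_all add: p_def q_def mult_assoc)
    have "a * q * x * a * b = a * (q * p) * b"
      by (simp add: p_def mult_assoc)
    also have "\<dots> = (a * p) * (q * b)"
      by (simp add: mult_assoc flip: pq)
    finally have e1: "a * q * x * (a * b) = a * b"
      using ap qb by (simp add: mult_assoc)
    have "y * p * b * (y * x) = y * (p * q) * x"
      by (simp add: q_def mult_assoc)
    also have "\<dots> = (y * q) * (p * x)"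
      by (simp add: mult_assoc pq)
    finally have e2: "y * p * b * (y * x) = y * x"
      by (simp add: yq px)
    \<comment> \<open>Moving \<open>g\<close> across \<open>q\<close> gives
      \<open>adj x * q * adj a\<close>, the adjoint of \<open>a * q * x\<close>. The fourth equation
      moves \<open>h\<close> across \<open>p\<close> likewise.\<close>
    have "a * q * x = adj x * (g * q) * x"
      using xg by (simp flip: mult_assoc)
    also have "\<dots> = adj x * q * (g * x)"
      by (simp add: mult_assoc flip: qg)
    finally have e3: "adj (a * q * x) = a * q * x"
      using gx q(2) by (simp add: adj_mult mult_assoc)
    have "y * p * b = y * (p * h) * adj y"
      using hy by (simp add: mult_assoc)
    also have "\<dots> = (y * h) * p * adj y"
      by (simp add: mult_assoc flip: hp)
    finally have e4: "adj (y * p * b) = y * p * b"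
      using yh p(2) by (simp add: adj_mult mult_assoc)
    show "penrose (a * b) (y * x)"
      unfolding penrose_def abyx yxab using e1 e2 e3 e4 by blast
  qed
qed

text \<open>Square roots of weights: \<open>r\<close> is a self-adjoint unit of the corner ring \<open>e R e\<close>.\<close>

definition selfadj_unit :: "'a \<Rightarrow> 'a \<Rightarrow> 'a \<Rightarrow> bool" where
  "selfadj_unit e r r' \<longleftrightarrow> adj e = e \<and> adj r = r \<and> adj r' = r' \<and>
     r * r' = e \<and> r' * r = e \<and> e * r = r \<and> e * r' = r'"

lemma selfadj_unit_sym: "selfadj_unit e r r' \<Longrightarrow> selfadj_unit e r' r"
  by (auto simp: selfadj_unit_def)

text \<open>The rules with a trailing factor \<open>z\<close> let simplification cancel inside
  longer right-associated products.\<close>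

lemma selfadj_unitD:
  assumes "selfadj_unit e r r'"
  shows "adj e = e" "adj r = r" "adj r' = r'" "r * r' = e" "r' * r = e"
    "e * r = r" "e * r' = r'" "r * e = r" "r' * e = r'" "e * e = e"
    "r * (r' * z) = e * z" "r' * (r * z) = e * z" "e * (r * z) = r * z" "e * (r' * z) = r' * z"
    "r * (e * z) = r * z" "r' * (e * z) = r' * z" "e * (e * z) = e * z"
proof -
  show *: "adj e = e" "adj r = r" "adj r' = r'" "r * r' = e" "r' * r = e" "e * r = r" "e * r' = r'"
    using assms by (auto simp: selfadj_unit_def)
  show "r * e = r" and re': "r' * e = r'"
    using * by (metis adj_mult)+
  then show "e * e = e"
    using * by (metis mult_assoc)
  then show "r * (r' * z) = e * z" "r' * (r * z) = e * z" "e * (r * z) = r * z"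
    "e * (r' * z) = r' * z" "r * (e * z) = r * z" "r' * (e * z) = r' * z" "e * (e * z) = e * z"
    using * \<open>r * e = r\<close> re' by (metis mult_assoc)+
qed

text \<open>Multiplying by \<open>r'\<close> and \<open>q'\<close> undoes \<open>r\<close> and
  \<open>q\<close> only up to \<open>e\<close> and \<open>f\<close>, hence the block conditions on
  \<open>u\<close> and \<open>v\<close>.\<close>

lemma selfadj_unit_cancel:
  assumes r: "selfadj_unit e r r'" and q: "selfadj_unit f q q'"
    and "e * u = u" "u * f = u" "e * v = v" "v * f = v"
  shows "r * u * q = r * v * q \<longleftrightarrow> u = v"
proof -
  have "r' * (r * w * q) * q' = w" if "e * w = w" "w * f = w" for w
    using that selfadj_unitD[OF r] selfadj_unitD[OF q] by (simp add: mult_assoc)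
  then show ?thesis
    using assms by metis
qed

section \<open>Reduction of weighted inverses to ordinary ones\<close>

definition weighted_penrose :: "'a \<Rightarrow> 'a \<Rightarrow> 'a \<Rightarrow> 'a \<Rightarrow> bool" where
  "weighted_penrose s t a x \<longleftrightarrow>
     a * x * a = a \<and> x * a * x = x \<and> adj (s * a * x) = s * a * x \<and> adj (t * x * a) = t * x * a"

text \<open>Products telescope since \<open>q' * q = f\<close> and \<open>r' * r = e\<close> are
  absorbed. For the symmetry conditions, sandwiching \<open>r * (a * x) * r'\<close> between two
  factors \<open>r\<close> gives \<open>r * r * a * x\<close>, and this preserves self-adjointness
  in both directions; likewise with \<open>q\<close>.\<close>

lemma weighted_penrose_iff:
  assumes r: "selfadj_unit e r r'" and q: "selfadj_unit f q q'"
    and a: "e * a = a" "a * f = a" and x: "f * x = x" "x * e = x"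
  shows "weighted_penrose (r * r) (q * q) a x \<longleftrightarrow> penrose (r * a * q') (q * x * r')"
proof -
  note R = selfadj_unitD[OF r] and Q = selfadj_unitD[OF q]
  have assoc: "f * (x * z) = x * z" "e * (a * z) = a * z"
    "e * (adj x * z) = adj x * z" "f * (adj a * z) = adj a * z" for z
    using a x R(1) Q(1) by (metis adj_mult mult_assoc)+
  have 1: "(r * a * q') * (q * x * r') * (r * a * q') = r * (a * x * a) * q'"
    and 2: "(q * x * r') * (r * a * q') * (q * x * r') = q * (x * a * x) * r'"
    and 3: "(r * a * q') * (q * x * r') = r * (a * x) * r'"
    and 4: "(q * x * r') * (r * a * q') = q * (x * a) * q'"
    by (simp_all add: R Q assoc mult_assoc)
  have "adj (r * (a * x) * r') = r * (a * x) * r' \<longleftrightarrow>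
      r * adj (r * (a * x) * r') * r = r * (r * (a * x) * r') * r"
    by (rule selfadj_unit_cancel[OF r r, symmetric])
      (simp_all add: R mult_assoc adj_mult)
  also have "r * adj (r * (a * x) * r') * r = adj (r * r * a * x)"
    by (simp add: R assoc adj_mult mult_assoc)
  also have "r * (r * (a * x) * r') * r = r * r * a * x"
    using x by (simp add: R mult_assoc)
  finally have 5: "adj (r * (a * x) * r') = r * (a * x) * r' \<longleftrightarrow> adj (r * r * a * x) = r * r * a * x" .
  have "adj (q * (x * a) * q') = q * (x * a) * q' \<longleftrightarrow>
      q * adj (q * (x * a) * q') * q = q * (q * (x * a) * q') * q"
    by (rule selfadj_unit_cancel[OF q q, symmetric])
      (simp_all add: Q mult_assoc adj_mult)
  also have "q * adj (q * (x * a) * q') * q = adj (q * q * x * a)"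
    by (simp add: Q assoc adj_mult mult_assoc)
  also have "q * (q * (x * a) * q') * q = q * q * x * a"
    using a by (simp add: Q mult_assoc)
  finally have 6: "adj (q * (x * a) * q') = q * (x * a) * q' \<longleftrightarrow> adj (q * q * x * a) = q * q * x * a" .
  have 7: "r * (a * x * a) * q' = r * a * q' \<longleftrightarrow> a * x * a = a"
    by (rule selfadj_unit_cancel[OF r selfadj_unit_sym[OF q]])
      (simp_all add: a assoc mult_assoc)
  have 8: "q * (x * a * x) * r' = q * x * r' \<longleftrightarrow> x * a * x = x"
    by (rule selfadj_unit_cancel[OF q selfadj_unit_sym[OF r]])
      (simp_all add: x assoc mult_assoc)
  show ?thesis
    unfolding weighted_penrose_def penrose_def 1 2 7 8 unfolding 3 4 5 6 ..
qed

text \<open>The substitution is undone on the ordinary inverse \<open>w\<close> of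
  \<open>r * a * q'\<close>, giving \<open>q' * w * r\<close>. The block conditions on
  \<open>x\<close> encode its shape; the weights see nothing outside their own blocks.\<close>

lemma ex1_weighted_penrose:
  assumes r: "selfadj_unit e r r'" and q: "selfadj_unit f q q'"
    and a: "e * a = a" "a * f = a"
  shows "\<exists>!x. f * x = x \<and> x * e = x \<and> weighted_penrose (r * r) (q * q) a x"
proof -
  note R = selfadj_unitD[OF r] and Q = selfadj_unitD[OF q]
  obtain w where w: "penrose (r * a * q') w"
    using penrose_exists by blast
  have fw: "f * w = w"
    by (rule penrose_left_unit[OF w]) (simp_all add: Q mult_assoc)
  have we: "w * e = w"
    by (rule penrose_right_unit[OF w]) (simp_all add: R flip: mult_assoc)
  have "q * (q' * w * r) * r' = w"
    by (simp add: R Q mult_assoc fw we)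
  then have "weighted_penrose (r * r) (q * q) a (q' * w * r)"
    using w by (subst weighted_penrose_iff[OF r q a]) (simp_all add: R Q mult_assoc)
  moreover have "x = y" if x: "f * x = x" "x * e = x" "weighted_penrose (r * r) (q * q) a x"
    and y: "f * y = y" "y * e = y" "weighted_penrose (r * r) (q * q) a y" for x y
    using x y penrose_unique weighted_penrose_iff[OF r q a]
      selfadj_unit_cancel[OF q selfadj_unit_sym[OF r]] by metis
  ultimately show ?thesis
    by (intro ex1I[of _ "q' * w * r"]) (auto simp: R Q mult_assoc)
qed

text \<open>Because \<open>q' * q = f\<close> is absorbed, the substituted factors multiply to the
  substituted product, so Greville's criterion applies to them.\<close>

theorem weighted_penrose_mult_iff:
  assumes r: "selfadj_unit e r r'" and q: "selfadj_unit f q q'" and l: "selfadj_unit g l l'"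
    and a: "e * a = a" "a * f = a" and b: "f * b = b" "b * g = b"
    and x: "f * x = x" "x * e = x" and y: "g * y = y" "y * f = y"
    and "weighted_penrose (r * r) (q * q) a x" and "weighted_penrose (q * q) (l * l) b y"
  shows "weighted_penrose (r * r) (l * l) (a * b) (y * x) \<longleftrightarrow>
      q' * q' * adj (x * a * b * (l' * l' * adj b * (q * q))) * (q * q) =
        x * a * b * (l' * l' * adj b * (q * q)) \<and>
      q' * q' * adj (q' * q' * adj a * (r * r) * a * b * y) * (q * q) =
        q' * q' * adj a * (r * r) * a * b * y"
proof -
  note R = selfadj_unitD[OF r] and Q = selfadj_unitD[OF q] and L = selfadj_unitD[OF l]
  have assoc: "f * (x * z) = x * z" "e * (a * z) = a * z" "f * (b * z) = b * z" "g * (y * z) = y * z"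
    "f * (adj a * z) = adj a * z" "g * (adj b * z) = adj b * z" for z
    using a b x y R Q L by (metis mult_assoc adj_mult)+
  have pa: "penrose (r * a * q') (q * x * r')" and pb: "penrose (q * b * l') (l * y * q')"
    using assms weighted_penrose_iff by auto
  \<comment> \<open>Conjugation by \<open>q\<close> turns the weighted adjoint of \<open>c\<close>
    into \<open>adj (q * c * q')\<close>, so weighted self-adjointness becomes ordinary
    self-adjointness.\<close>
  have conj: "q' * q' * adj c * (q * q) = c \<longleftrightarrow> adj (q * c * q') = q * c * q'"
    if c: "f * c = c" "c * f = c" for c
  proof -
    have "adj c * f = adj c" "f * adj c = adj c"
      using c Q by (metis adj_mult)+
    then have cf: "f * (adj c * z) = adj c * z" for z
      by (metis mult_assoc)
    have "q' * q' * adj c * (q * q) = c \<longleftrightarrow> q * (q' * q' * adj c * (q * q)) * q' = q * c * q'"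
      by (rule selfadj_unit_cancel[OF q selfadj_unit_sym[OF q], symmetric])
        (simp_all add: c Q mult_assoc)
    also have "q * (q' * q' * adj c * (q * q)) * q' = adj (q * c * q')"
      using \<open>adj c * f = adj c\<close> by (simp add: Q mult_assoc adj_mult)
    finally show ?thesis .
  qed
  have c1: "q * (x * a * b * (l' * l' * adj b * (q * q))) * q' =
      q * x * r' * (r * a * q') * (q * b * l') * adj (q * b * l')"
    by (simp add: R Q L mult_assoc adj_mult assoc)
  have c2: "q * (q' * q' * adj a * (r * r) * a * b * y) * q' =
      adj (r * a * q') * (r * a * q') * (q * b * l') * (l * y * q')"
    by (simp add: R Q L mult_assoc adj_mult assoc)
  have "weighted_penrose (r * r) (l * l) (a * b) (y * x) \<longleftrightarrow>
      penrose (r * (a * b) * l') (l * (y * x) * r')"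
    by (rule weighted_penrose_iff[OF r l]) (simp_all add: a b x y assoc mult_assoc)
  also have "r * (a * b) * l' = r * a * q' * (q * b * l')"
    by (simp add: Q mult_assoc assoc)
  also have "l * (y * x) * r' = l * y * q' * (q * x * r')"
    by (simp add: Q mult_assoc assoc)
  also note penrose_mult_iff[OF pa pb]
  also note c1[symmetric]
  also note c2[symmetric]
  finally show ?thesis
    by (subst (1 2) conj) (simp_all only: assoc mult_assoc Q y)
qed

end

subsection \<open>The ring of finitely supported matrices\<close>

text \<open>Rectangular matrices of all shapes live in one type, so products carry no dimension
  conditions. Over an infinite index type there is no unit; idempotents take over the role of the
  identities.\<close>

typedef 'i fmat = "{f :: 'i \<Rightarrow> 'i \<Rightarrow> complex. finite {(i, j). f i j \<noteq> 0}}"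
  by (rule exI[of _ "\<lambda>_ _. 0"]) simp

setup_lifting type_definition_fmat

lift_definition coeff :: "'i fmat \<Rightarrow> 'i \<Rightarrow> 'i \<Rightarrow> complex" is "\<lambda>f. f" .

lift_definition mk_fmat :: "'i set \<Rightarrow> 'i set \<Rightarrow> ('i \<Rightarrow> 'i \<Rightarrow> complex) \<Rightarrow> 'i fmat" is
  "\<lambda>F G f i j. if finite F \<and> finite G \<and> i \<in> F \<and> j \<in> G then f i j else 0"
  subgoal for F G f
    by (cases "finite F \<and> finite G", rule finite_subset[of _ "F \<times> G"]) auto
  done

lemma coeff_mk_fmat:
  "finite F \<Longrightarrow> finite G \<Longrightarrow> coeff (mk_fmat F G f) i j = (if i \<in> F \<and> j \<in> G then f i j else 0)"
  by transfer simp

lemma fmat_eqI: "(\<And>i j. coeff x i j = coeff y i j) \<Longrightarrow> x = y"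
  by transfer (simp add: fun_eq_iff)

text \<open>Rows and columns are pooled so that one finite set can serve as the summation range of
  any product with this factor.\<close>

definition indices :: "'i fmat \<Rightarrow> 'i set" where
  "indices x = {i. \<exists>j. coeff x i j \<noteq> 0 \<or> coeff x j i \<noteq> 0}"

lemma finite_indices [simp]: "finite (indices x)"
proof -
  have "finite {(i, j). coeff x i j \<noteq> 0}"
    by transfer
  then have "finite (fst ` {(i, j). coeff x i j \<noteq> 0} \<union> snd ` {(i, j). coeff x i j \<noteq> 0})"
    by simp
  then show ?thesis
    by (rule finite_subset[rotated]) (force simp: indices_def)
qed

lemma coeff_eq_0: "i \<notin> indices x \<Longrightarrow> coeff x i j = 0" "j \<notin> indices x \<Longrightarrow> coeff x i j = 0"
  by (auto simp: indices_def)

instantiation fmat :: (type) ring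
begin

lift_definition zero_fmat :: "'a fmat" is "\<lambda>_ _. 0"
  by simp

lift_definition plus_fmat :: "'a fmat \<Rightarrow> 'a fmat \<Rightarrow> 'a fmat" is "\<lambda>f g i j. f i j + g i j"
  subgoal for f g
    by (rule finite_subset[of _ "{(i, j). f i j \<noteq> 0} \<union> {(i, j). g i j \<noteq> 0}"]) auto
  done

lift_definition uminus_fmat :: "'a fmat \<Rightarrow> 'a fmat" is "\<lambda>f i j. - f i j"
  by simp

lift_definition minus_fmat :: "'a fmat \<Rightarrow> 'a fmat \<Rightarrow> 'a fmat" is "\<lambda>f g i j. f i j - g i j"
  subgoal for f g
    by (rule finite_subset[of _ "{(i, j). f i j \<noteq> 0} \<union> {(i, j). g i j \<noteq> 0}"]) auto
  done

definition times_fmat :: "'a fmat \<Rightarrow> 'a fmat \<Rightarrow> 'a fmat" where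
  "x * y = mk_fmat (indices x) (indices y) (\<lambda>i k. \<Sum>j\<in>indices x. coeff x i j * coeff y j k)"

lemma coeff_simps [simp]:
  "coeff 0 i j = 0" "coeff (x + y) i j = coeff x i j + coeff y i j"
  "coeff (- x) i j = - coeff x i j" "coeff (x - y) i j = coeff x i j - coeff y i j"
  by (transfer; simp)+

text \<open>The summation range is free as long as it contains all contributing indices: a common
  range for several products, or a single index for a diagonal factor.\<close>

lemma coeff_times:
  assumes "finite F" and "\<And>j. coeff x i j * coeff y j k \<noteq> 0 \<Longrightarrow> j \<in> F"
  shows "coeff (x * y) i k = (\<Sum>j\<in>F. coeff x i j * coeff y j k)"
proof -
  have "coeff (x * y) i k = (\<Sum>j\<in>indices x. coeff x i j * coeff y j k)"
    by (auto simp: times_fmat_def coeff_mk_fmat coeff_eq_0)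
  also have "\<dots> = (\<Sum>j\<in>F. coeff x i j * coeff y j k)"
    by (intro sum.mono_neutral_cong) (use assms coeff_eq_0 in auto)
  finally show ?thesis .
qed

lemma coeff_times':
  assumes "finite F" and "indices x \<subseteq> F \<or> indices y \<subseteq> F"
  shows "coeff (x * y) i k = (\<Sum>j\<in>F. coeff x i j * coeff y j k)"
  by (rule coeff_times) (use assms coeff_eq_0 in fastforce)+

instance
proof
  fix x y z :: "'a fmat"
  define F where "F = indices x \<union> indices y \<union> indices z"
  have F: "finite F" and sub: "indices x \<subseteq> F" "indices y \<subseteq> F" "indices z \<subseteq> F"
    by (auto simp: F_def)
  have "coeff (x * y * z) i k = coeff (x * (y * z)) i k" for i k
    using sub by (simp add: coeff_times'[OF F] sum_distrib_left sum_distrib_right mult.assoc)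
      (rule sum.swap)
  then show "x * y * z = x * (y * z)"
    by (rule fmat_eqI)
  show "(x + y) * z = x * z + y * z" "x * (y + z) = x * y + x * z"
    by (rule fmat_eqI; use sub in \<open>simp add: coeff_times'[OF F] algebra_simps sum.distrib\<close>)+
qed (rule fmat_eqI; simp)+

end

section \<open>Von Neumann regularity of the matrix ring\<close>

lemma sum_fun_apply: "(\<Sum>k\<in>F. v k) i = (\<Sum>k\<in>F. v k i)"
  by (induction F rule: infinite_finite_induct) simp_all

lemma coeff_matrix_vector_linear:
  "Vector_Spaces.linear (\<lambda>c v i. c * v i) (\<lambda>c v i. c * v i)
     (\<lambda>v i. \<Sum>j\<in>F. coeff x i j * v j)"
  for x :: "'i fmat"
  by unfold_locales (auto simp: fun_eq_iff algebra_simps sum.distrib sum_distrib_left)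

text \<open>The matrix acts as a linear map \<open>f\<close> on all functions; a linear right
  inverse of \<open>f\<close> on its range, written as a matrix, is the required
  \<open>g\<close>.\<close>

lemma fmat_von_Neumann_regular: "\<exists>g. x * g * x = x" for x :: "'i fmat"
proof -
  let ?scale = "\<lambda>(c :: complex) v (i :: 'i). c * v i"
  define F where "F = indices x"
  have F: "finite F" by (simp add: F_def)
  interpret vector_space_pair ?scale ?scale
    by unfold_locales (auto simp: fun_eq_iff algebra_simps)
  define f where "f = (\<lambda>v i. \<Sum>j\<in>F. coeff x i j * v j)"
  have "Vector_Spaces.linear ?scale ?scale f"
    unfolding f_def by (rule coeff_matrix_vector_linear)
  then obtain h where h: "Vector_Spaces.linear ?scale ?scale h" and fhf: "f (h (f v)) = f v" for v
    using linear_exists_right_inverse_on[of f UNIV] by auto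
  define \<delta> :: "'i \<Rightarrow> 'i \<Rightarrow> complex" where "\<delta> i j = of_bool (i = j)" for i j
  \<comment> \<open>Truncating the matrix of \<open>h\<close> to \<open>F\<close> is harmless:
    \<open>f\<close> reads only coordinates in \<open>F\<close> and its values vanish outside
    \<open>F\<close>.\<close>
  define g where "g = mk_fmat F F (\<lambda>j i. h (\<delta> i) j)"
  have f\<delta>: "f (\<delta> k) i = coeff x i k" for i k
  proof (cases "k \<in> F")
    case True
    then show ?thesis
      using F by (simp add: f_def \<delta>_def sum.If_cases of_bool_def if_distrib[of "\<lambda>c. _ * c"] cong: if_cong)
  next
    case False
    then show ?thesis
      using coeff_eq_0 by (auto simp: f_def \<delta>_def F_def intro!: sum.neutral)
  qed
  have "coeff (x * g * x) i k = coeff x i k" for i k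
  proof -
    \<comment> \<open>The column \<open>f (\<delta> k)\<close> is a finite combination of basis
      vectors, so linearity expresses \<open>h\<close> on it by the entries of
      \<open>g\<close>.\<close>
    have "h (f (\<delta> k)) = h (\<Sum>l\<in>F. ?scale (coeff x l k) (\<delta> l))"
    proof (rule arg_cong[of _ _ h], rule ext)
      fix i
      show "f (\<delta> k) i = (\<Sum>l\<in>F. ?scale (coeff x l k) (\<delta> l)) i"
        using F by (cases "i \<in> F")
          (auto simp: f\<delta> sum_fun_apply \<delta>_def of_bool_def if_distrib[of "\<lambda>c. _ * c"] F_def coeff_eq_0 cong: if_cong)
    qed
    also have "\<dots> = (\<Sum>l\<in>F. ?scale (coeff x l k) (h (\<delta> l)))"
      using h by (simp add: linear_sum linear_scale)
    finally have hf: "h (f (\<delta> k)) j = (\<Sum>l\<in>F. coeff x l k * h (\<delta> l) j)" for j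
      by (simp add: sum_fun_apply)
    have "coeff (x * g * x) i k = (\<Sum>l\<in>F. (\<Sum>j\<in>F. coeff x i j * h (\<delta> l) j) * coeff x l k)"
      using F by (simp add: coeff_times'[of F] F_def[symmetric] g_def coeff_mk_fmat)
    also have "\<dots> = (\<Sum>j\<in>F. coeff x i j * (\<Sum>l\<in>F. coeff x l k * h (\<delta> l) j))"
      unfolding sum_distrib_left sum_distrib_right
      by (subst sum.swap) (simp add: mult_ac)
    also have "\<dots> = f (h (f (\<delta> k))) i"
      unfolding hf[symmetric] by (simp add: f_def)
    also have "\<dots> = coeff x i k"
      by (simp add: fhf f\<delta>)
    finally show ?thesis .
  qed
  then show ?thesis
    using fmat_eqI by blast
qed

instantiation fmat :: (type) regular_star_ring
begin

lift_definition adj_fmat :: "'a fmat \<Rightarrow> 'a fmat" is "\<lambda>f i j. cnj (f j i)"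
  subgoal for f
    by (rule finite_subset[of _ "prod.swap ` {(i, j). f i j \<noteq> 0}"]) force+
  done

lemma coeff_adj [simp]: "coeff (adj x) i j = cnj (coeff x j i)"
  by transfer simp

lemma indices_adj [simp]: "indices (adj x) = indices x"
  by (auto simp: indices_def)

instance
proof
  fix x y :: "'a fmat"
  show "adj (adj x) = x" "adj (x - y) = adj x - adj y"
    by (rule fmat_eqI; simp)+
  show "adj (x * y) = adj y * adj x"
    by (rule fmat_eqI) (simp add: coeff_times'[of "indices x"] mult.commute)
  show "\<exists>g. x * g * x = x"
    by (rule fmat_von_Neumann_regular)
  assume 0: "adj x * x = 0"
  show "x = 0"
  proof (rule fmat_eqI)
    fix i k
    \<comment> \<open>A diagonal entry of \<open>adj x * x\<close> is the squared norm of a column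
      of \<open>x\<close>, which gives properness.\<close>
    have "(\<Sum>j\<in>indices x. complex_of_real ((cmod (coeff x j k))\<^sup>2)) = coeff (adj x * x) k k"
      by (simp add: coeff_times'[of "indices x"] complex_norm_square mult.commute del: of_real_power)
    then have "(\<Sum>j\<in>indices x. (cmod (coeff x j k))\<^sup>2) = 0"
      unfolding 0 by (simp only: of_real_sum[symmetric] coeff_simps of_real_eq_0_iff)
    then have "\<forall>j\<in>indices x. coeff x j k = 0"
      by (simp add: sum_nonneg_eq_0_iff)
    then show "coeff x i k = coeff 0 i k"
      using coeff_eq_0(1)[of i x k] by auto
  qed
qed

end

section \<open>Diagonal matrices and square roots by diagonalization\<close>

definition diag_fmat :: "'i set \<Rightarrow> ('i \<Rightarrow> complex) \<Rightarrow> 'i fmat" where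
  "diag_fmat F d = mk_fmat F F (\<lambda>i j. if i = j then d i else 0)"

lemma coeff_diag_fmat:
  "finite F \<Longrightarrow> coeff (diag_fmat F d) i j = (if i \<in> F \<and> i = j then d i else 0)"
  by (auto simp: diag_fmat_def coeff_mk_fmat)

lemma coeff_diag_times:
  assumes "finite F"
  shows "coeff (diag_fmat F d * x) i j = (if i \<in> F then d i * coeff x i j else 0)"
  using assms by (subst coeff_times[of "{i}"]) (auto simp: coeff_diag_fmat split: if_splits)

lemma coeff_times_diag:
  assumes "finite F"
  shows "coeff (x * diag_fmat F d) i j = (if j \<in> F then coeff x i j * d j else 0)"
  using assms by (subst coeff_times[of "{j}"]) (auto simp: coeff_diag_fmat split: if_splits)

lemma diag_times_diag:
  "finite F \<Longrightarrow> diag_fmat F c * diag_fmat F d = diag_fmat F (\<lambda>i. c i * d i)"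
  by (rule fmat_eqI) (auto simp: coeff_diag_times coeff_diag_fmat)

lemma adj_diag: "finite F \<Longrightarrow> adj (diag_fmat F d) = diag_fmat F (\<lambda>i. cnj (d i))"
  by (rule fmat_eqI) (auto simp: coeff_diag_fmat)

lemma diag_fmat_cong:
  "finite F \<Longrightarrow> (\<And>i. i \<in> F \<Longrightarrow> c i = d i) \<Longrightarrow> diag_fmat F c = diag_fmat F d"
  by (rule fmat_eqI) (auto simp: coeff_diag_fmat)

text \<open>Conjugate by \<open>u\<close> the diagonal matrices of the square roots of the
  eigenvalues and of their reciprocals; positivity makes both real and mutually inverse.\<close>

lemma selfadj_unit_sqrt:
  fixes \<rho> :: "'i \<Rightarrow> real"
  assumes "finite F" and u: "u * adj u = diag_fmat F (\<lambda>_. 1)" "adj u * u = diag_fmat F (\<lambda>_. 1)"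
    and "\<And>i. i \<in> F \<Longrightarrow> \<rho> i > 0"
    and e: "diag_fmat F (\<lambda>_. 1) * u = u"
  obtains r r' where "selfadj_unit (diag_fmat F (\<lambda>_. 1)) r r'"
    and "r * r = u * diag_fmat F (\<lambda>i. complex_of_real (\<rho> i)) * adj u"
proof -
  define E D D' where "E = diag_fmat F (\<lambda>_. 1)" and "D = diag_fmat F (\<lambda>i. complex_of_real (sqrt (\<rho> i)))"
    and "D' = diag_fmat F (\<lambda>i. complex_of_real (1 / sqrt (\<rho> i)))"
  have D: "adj D = D" "adj D' = D'" "adj E = E"
    using assms(1) by (simp_all add: D_def D'_def E_def adj_diag)
  have "complex_of_real (sqrt (\<rho> i)) * complex_of_real (1 / sqrt (\<rho> i)) = 1"
    "complex_of_real (sqrt (\<rho> i)) * complex_of_real (sqrt (\<rho> i)) = complex_of_real (\<rho> i)"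
    if "i \<in> F" for i
    unfolding of_real_mult[symmetric] using assms(4)[OF that] by auto
  then have DD': "D * D' = E" and "D * D = diag_fmat F (\<lambda>i. complex_of_real (\<rho> i))"
    using assms(1) by (auto simp: D_def D'_def E_def diag_times_diag simp del: of_real_divide
        intro!: diag_fmat_cong)
  have D'D: "D' * D = E"
    using DD' D by (metis adj_mult)
  have ED: "E * D = D" "E * D' = D'" "E * E = E"
    using assms(1) by (auto simp: D_def D'_def E_def diag_times_diag)
  have uu: "u * adj u = E" "adj u * u = E" "E * u = u"
    using assms by (simp_all add: E_def)
  have assoc: "u * (adj u * z) = E * z" "adj u * (u * z) = E * z" "E * (u * z) = u * z" "D * (E * z) = D * z"
    "D' * (E * z) = D' * z" "D' * (D * z) = E * z" "D * (D' * z) = E * z" "E * (D * z) = D * z"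
    "E * (D' * z) = D' * z" "E * adj u = adj u" "E * (adj u * z) = adj u * z" for z
    using DD' D'D ED uu D by (metis mult.assoc adj_mult adj_adj)+
  show ?thesis
  proof (rule that)
    show "selfadj_unit (diag_fmat F (\<lambda>_. 1)) (u * D * adj u) (u * D' * adj u)"
      unfolding selfadj_unit_def E_def[symmetric]
      by (simp add: adj_mult mult.assoc assoc D uu)
    show "u * D * adj u * (u * D * adj u) = u * diag_fmat F (\<lambda>i. complex_of_real (\<rho> i)) * adj u"
      unfolding \<open>D * D = _\<close>[symmetric] by (simp add: mult.assoc assoc)
  qed
qed

subsection \<open>Tensors as matrices over multi-indices\<close>

lemma finite_multi_indices [simp]: "finite (multi_indices ds)"
proof (rule finite_subset)
  \<comment> \<open>For \<open>ds = []\<close> the maximum is unspecified, but the only multi-index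
    is then the empty list.\<close>
  show "multi_indices ds \<subseteq> {xs. set xs \<subseteq> {..<Max (set ds)} \<and> length xs = length ds}"
    by (auto simp: multi_indices_def list_all2_conv_all_nth in_set_conv_nth)
      (metis List.finite_set Max_ge nth_mem order_less_le_trans)
qed (rule finite_lists_length_eq, simp)

lemma length_multi_indices: "ix \<in> multi_indices ds \<Longrightarrow> length ix = length ds"
  by (auto simp: multi_indices_def list_all2_lengthD)

lemma append_in_multi_indices:
  "length i = length ds \<Longrightarrow> i @ j \<in> multi_indices (ds @ es) \<longleftrightarrow> i \<in> multi_indices ds \<and> j \<in> multi_indices es"
  by (auto simp: multi_indices_def list_all2_append)

lemma multi_indices_appendE:
  assumes "ix \<in> multi_indices (ds @ es)"
  obtains i j where "ix = i @ j" "i \<in> multi_indices ds" "j \<in> multi_indices es"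
  using assms by (auto simp: multi_indices_def list_all2_append2)

text \<open>A tensor does not record where its indices split into rows and columns, so both groups
  are arguments.\<close>

definition to_fmat :: "nat list \<Rightarrow> nat list \<Rightarrow> ctensor \<Rightarrow> nat list fmat" where
  "to_fmat Is Js A = mk_fmat (multi_indices Is) (multi_indices Js) (\<lambda>i j. entry A (i @ j))"

definition of_fmat :: "nat list \<Rightarrow> nat list \<Rightarrow> nat list fmat \<Rightarrow> ctensor" where
  "of_fmat Is Js x = mk_tensor (Is @ Js) (\<lambda>ix. coeff x (take (length Is) ix) (drop (length Is) ix))"

text \<open>The equations \<open>id_fmat Is * x = x\<close> and \<open>x * id_fmat Js = x\<close>
  together express that \<open>x\<close> is supported on the block of shape \<open>Is\<close> by
  \<open>Js\<close>.\<close>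

definition id_fmat :: "nat list \<Rightarrow> nat list fmat" where
  "id_fmat Is = diag_fmat (multi_indices Is) (\<lambda>_. 1)"

lemma coeff_to_fmat:
  "coeff (to_fmat Is Js A) i j =
    (if i \<in> multi_indices Is \<and> j \<in> multi_indices Js then entry A (i @ j) else 0)"
  by (simp add: to_fmat_def coeff_mk_fmat)

lemma to_fmat_inject:
  assumes "A \<in> tensors (Is @ Js)" and "B \<in> tensors (Is @ Js)"
  shows "to_fmat Is Js A = to_fmat Is Js B \<longleftrightarrow> A = B"
proof
  assume eq: "to_fmat Is Js A = to_fmat Is Js B"
  show "A = B"
  proof (rule ctensor_eqI)
    fix ix assume "ix \<in> multi_indices (dims A)"
    then have "ix \<in> multi_indices (Is @ Js)"
      using assms by (simp add: tensors_def)
    then show "entry A ix = entry B ix"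
      by (rule multi_indices_appendE) (use eq coeff_to_fmat in metis)
  qed (use assms in \<open>simp add: tensors_def\<close>)
qed simp

lemma of_fmat_in_tensors: "of_fmat Is Js x \<in> tensors (Is @ Js)"
  by (simp add: of_fmat_def tensors_def)

lemma to_fmat_of_fmat:
  assumes "id_fmat Is * x = x" and "x * id_fmat Js = x"
  shows "to_fmat Is Js (of_fmat Is Js x) = x"
proof (rule fmat_eqI)
  fix i j
  have "coeff (to_fmat Is Js (of_fmat Is Js x)) i j = coeff (id_fmat Is * (x * id_fmat Js)) i j"
    by (auto simp: coeff_to_fmat of_fmat_def entry_mk_tensor append_in_multi_indices
        length_multi_indices id_fmat_def coeff_diag_times coeff_times_diag)
  then show "coeff (to_fmat Is Js (of_fmat Is Js x)) i j = coeff x i j"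
    using assms by simp
qed

lemma id_fmat_times_to_fmat [simp]: "id_fmat Is * to_fmat Is Js A = to_fmat Is Js A"
  by (rule fmat_eqI) (simp add: id_fmat_def coeff_diag_times coeff_to_fmat)

lemma to_fmat_times_id_fmat [simp]: "to_fmat Is Js A * id_fmat Js = to_fmat Is Js A"
  by (rule fmat_eqI) (simp add: id_fmat_def coeff_times_diag coeff_to_fmat)

lemma einstein_prod_in_tensors:
  "A \<in> tensors (Is @ Js) \<Longrightarrow> B \<in> tensors (Js @ Ks) \<Longrightarrow> length Js = N \<Longrightarrow>
    A \<star>\<^bsub>N\<^esub> B \<in> tensors (Is @ Ks)"
  by (auto simp: tensors_def einstein_prod_def Let_def)

text \<open>The contracted indices are the middle index of a matrix product, and only those in
  \<open>multi_indices Js\<close> contribute.\<close>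

lemma to_fmat_einstein_prod:
  assumes "A \<in> tensors (Is @ Js)" and "B \<in> tensors (Js @ Ks)" and "length Js = N"
  shows "to_fmat Is Ks (A \<star>\<^bsub>N\<^esub> B) = to_fmat Is Js A * to_fmat Js Ks B"
proof (rule fmat_eqI)
  fix i k
  have "coeff (to_fmat Is Js A * to_fmat Js Ks B) i k =
      (\<Sum>j\<in>multi_indices Js. coeff (to_fmat Is Js A) i j * coeff (to_fmat Js Ks B) j k)"
    by (rule coeff_times) (auto simp: coeff_to_fmat split: if_splits)
  then show "coeff (to_fmat Is Ks (A \<star>\<^bsub>N\<^esub> B)) i k = coeff (to_fmat Is Js A * to_fmat Js Ks B) i k"
    using assms
    by (auto simp: coeff_to_fmat einstein_prod_def Let_def entry_mk_tensor append_in_multi_indices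
        length_multi_indices tensors_def)
qed

lemma conj_transpose_in_tensors:
  "A \<in> tensors (Is @ Js) \<Longrightarrow> length Is = M \<Longrightarrow> conj_transpose M A \<in> tensors (Js @ Is)"
  by (auto simp: tensors_def conj_transpose_def Let_def)

lemma to_fmat_conj_transpose:
  "A \<in> tensors (Is @ Js) \<Longrightarrow> length Is = M \<Longrightarrow>
    to_fmat Js Is (conj_transpose M A) = adj (to_fmat Is Js A)"
  by (rule fmat_eqI)
    (auto simp: coeff_to_fmat tensors_def conj_transpose_def Let_def entry_mk_tensor
      append_in_multi_indices length_multi_indices)

lemma identity_tensor_in_tensors: "identity_tensor Is \<in> tensors (Is @ Is)"
  by (simp add: identity_tensor_def tensors_def)

text \<open>A product of Kronecker deltas is the delta of the multi-indices: one differing position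
  makes it vanish.\<close>

lemma to_fmat_identity_tensor: "to_fmat Is Is (identity_tensor Is) = id_fmat Is"
proof (rule fmat_eqI)
  fix i j :: "nat list"
  have "(\<Prod>k<length Is. of_bool ((i @ j) ! k = (i @ j) ! (length Is + k))) = (of_bool (i = j) :: complex)"
    if len: "length i = length Is" "length j = length Is"
  proof (cases "i = j")
    case True
    then show ?thesis
      using len by (auto simp: nth_append intro!: prod.neutral)
  next
    case False
    then obtain k where "k < length Is" "i ! k \<noteq> j ! k"
      using len by (auto simp: list_eq_iff_nth_eq)
    then show ?thesis
      using len False by (auto simp: nth_append intro!: bexI[of _ k])
  qed
  then show "coeff (to_fmat Is Is (identity_tensor Is)) i j = coeff (id_fmat Is) i j"
    by (auto simp: coeff_to_fmat id_fmat_def coeff_diag_fmat identity_tensor_def entry_mk_tensor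
        append_in_multi_indices length_multi_indices)
qed

section \<open>Square roots and inverses of the weight tensors\<close>

text \<open>The diagonalization of \<open>P\<close> by a unitary tensor translates into the ring,
  where \<open>selfadj_unit_sqrt\<close> applies.\<close>

lemma hermitian_pos_def_root:
  assumes "hermitian_pos_def Is P"
  obtains r r' where "P \<in> tensors (Is @ Is)" and "selfadj_unit (id_fmat Is) r r'"
    and "to_fmat Is Is P = r * r"
proof -
  define K where "K = length Is"
  obtain U D where U: "U \<in> tensors (Is @ Is)" "U \<star>\<^bsub>K\<^esub> conj_transpose K U = identity_tensor Is"
      "conj_transpose K U \<star>\<^bsub>K\<^esub> U = identity_tensor Is"
    and D: "diagonal_tensor Is D"
    and pos: "\<forall>i\<in>multi_indices Is. \<exists>\<rho>>0. entry D (i @ i) = complex_of_real \<rho>"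
    and P: "P = U \<star>\<^bsub>K\<^esub> D \<star>\<^bsub>K\<^esub> conj_transpose K U"
    using assms by (auto simp: hermitian_pos_def_def unitary_tensor_def Let_def K_def)
  obtain \<rho> where \<rho>: "\<And>i. i \<in> multi_indices Is \<Longrightarrow> \<rho> i > 0"
      "\<And>i. i \<in> multi_indices Is \<Longrightarrow> entry D (i @ i) = complex_of_real (\<rho> i)"
    using pos by metis
  have Dt: "D \<in> tensors (Is @ Is)"
    using D by (simp add: diagonal_tensor_def)
  note UH = conj_transpose_in_tensors[OF U(1) K_def[symmetric]]
  note K = K_def[symmetric]
  define u where "u = to_fmat Is Is U"
  have UHu: "to_fmat Is Is (conj_transpose K U) = adj u"
    using U K by (simp add: u_def to_fmat_conj_transpose)
  have "u * adj u = id_fmat Is" "adj u * u = id_fmat Is"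
    using U(2,3)[THEN arg_cong[of _ _ "to_fmat Is Is"]] UHu
    by (simp_all add: to_fmat_einstein_prod[OF U(1) UH K] to_fmat_einstein_prod[OF UH U(1) K]
        to_fmat_identity_tensor u_def)
  moreover have "id_fmat Is * u = u"
    by (simp add: u_def)
  ultimately obtain r r' where r: "selfadj_unit (id_fmat Is) r r'"
      "r * r = u * diag_fmat (multi_indices Is) (\<lambda>i. complex_of_real (\<rho> i)) * adj u"
    unfolding id_fmat_def using selfadj_unit_sqrt[of "multi_indices Is" u \<rho>] \<rho>(1)
    by (metis finite_multi_indices)
  have "to_fmat Is Is D = diag_fmat (multi_indices Is) (\<lambda>i. complex_of_real (\<rho> i))"
    using D by (intro fmat_eqI) (auto simp: coeff_to_fmat coeff_diag_fmat \<rho>(2) diagonal_tensor_def)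
  then have "to_fmat Is Is P = r * r"
    unfolding P r(2)
    by (simp add: to_fmat_einstein_prod[OF einstein_prod_in_tensors UH K, OF U(1) Dt K]
        to_fmat_einstein_prod[OF U(1) Dt K] UHu flip: u_def)
  moreover have "P \<in> tensors (Is @ Is)"
    unfolding P by (intro einstein_prod_in_tensors[of _ _ Is] U(1) Dt UH K)
  ultimately show ?thesis
    using that r(1) by blast
qed

text \<open>The tensor of \<open>r' * r'\<close> is the only two-sided inverse of \<open>P\<close>,
  so the definite description selects it.\<close>

lemma to_fmat_inverse_tensor:
  assumes P: "P \<in> tensors (Is @ Is)" and K: "length Is = K"
    and r: "selfadj_unit (id_fmat Is) r r'" and Pr: "to_fmat Is Is P = r * r"
  shows "inverse_tensor K P \<in> tensors (Is @ Is)" "to_fmat Is Is (inverse_tensor K P) = r' * r'"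
proof -
  note R = selfadj_unitD[OF r]
  define Q where "Q = of_fmat Is Is (r' * r')"
  have Qt: "Q \<in> tensors (Is @ Is)"
    by (simp add: Q_def of_fmat_in_tensors)
  have Q: "to_fmat Is Is Q = r' * r'"
    unfolding Q_def by (rule to_fmat_of_fmat) (simp_all add: R mult.assoc)
  have iff: "P \<star>\<^bsub>K\<^esub> X = identity_tensor Is \<and> X \<star>\<^bsub>K\<^esub> P = identity_tensor Is \<longleftrightarrow> X = Q"
    if X: "X \<in> tensors (Is @ Is)" for X
  proof -
    let ?x = "to_fmat Is Is X"
    have "P \<star>\<^bsub>K\<^esub> X = identity_tensor Is \<and> X \<star>\<^bsub>K\<^esub> P = identity_tensor Is \<longleftrightarrow>
        r * r * ?x = id_fmat Is \<and> ?x * (r * r) = id_fmat Is"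
      using P X K
      by (simp add: Pr to_fmat_einstein_prod to_fmat_identity_tensor
          flip: to_fmat_inject[OF einstein_prod_in_tensors identity_tensor_in_tensors])
    also have "\<dots> \<longleftrightarrow> ?x = r' * r'"
    proof
      assume "r * r * ?x = id_fmat Is \<and> ?x * (r * r) = id_fmat Is"
      then have "r' * (r' * (r * r * ?x)) = r' * (r' * id_fmat Is)"
        by simp
      then show "?x = r' * r'"
        by (simp add: R mult.assoc)
    qed (simp add: R mult.assoc)
    also have "\<dots> \<longleftrightarrow> X = Q"
      using to_fmat_inject[OF X Qt] Q by simp
    finally show ?thesis .
  qed
  have "inverse_tensor K P = Q"
    unfolding inverse_tensor_def Let_def
    by (rule the_equality) (use P K iff Qt in \<open>auto simp: tensors_def\<close>)
  then show "inverse_tensor K P \<in> tensors (Is @ Is)" "to_fmat Is Is (inverse_tensor K P) = r' * r'"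
    using Qt Q by auto
qed

lemma to_fmat_weighted_conj_transpose:
  assumes A: "A \<in> tensors (Is @ Js)" and M: "length Is = M" and N: "length Js = N"
    and S: "S \<in> tensors (Is @ Is)" and T: "T \<in> tensors (Js @ Js)"
    and q: "selfadj_unit (id_fmat Js) q q'" and Tq: "to_fmat Js Js T = q * q"
  shows "weighted_conj_transpose M N S T A \<in> tensors (Js @ Is)"
    and "to_fmat Js Is (weighted_conj_transpose M N S T A) =
      q' * q' * adj (to_fmat Is Js A) * to_fmat Is Is S"
proof -
  note i = to_fmat_inverse_tensor[OF T N q Tq] and H = conj_transpose_in_tensors[OF A M]
  note iH = einstein_prod_in_tensors[OF i(1) H N]
  show "weighted_conj_transpose M N S T A \<in> tensors (Js @ Is)"
    unfolding weighted_conj_transpose_def by (rule einstein_prod_in_tensors[OF iH S M])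
  show "to_fmat Js Is (weighted_conj_transpose M N S T A) =
      q' * q' * adj (to_fmat Is Js A) * to_fmat Is Is S"
    unfolding weighted_conj_transpose_def
    by (simp add: to_fmat_einstein_prod[OF iH S M] to_fmat_einstein_prod[OF i(1) H N] i(2)
        to_fmat_conj_transpose[OF A M])
qed

section \<open>Weighted inverses of tensors and their reverse order law\<close>

text \<open>Both sides of each equation have the same known shape, so injectivity of
  \<open>to_fmat\<close> transfers the equation to the ring.\<close>

lemma is_weighted_pinv_iff:
  assumes A: "A \<in> tensors (Is @ Js)" and M: "length Is = M" and N: "length Js = N"
    and S: "S \<in> tensors (Is @ Is)" and T: "T \<in> tensors (Js @ Js)"
    and X: "X \<in> tensors (Js @ Is)"
  shows "is_weighted_pinv M N S T A X \<longleftrightarrow>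
    weighted_penrose (to_fmat Is Is S) (to_fmat Js Js T) (to_fmat Is Js A) (to_fmat Js Is X)"
proof -
  have d: "drop M (dims A) @ take M (dims A) = Js @ Is"
    using A M by (auto simp: tensors_def)
  note AX = einstein_prod_in_tensors[OF A X N] and XA = einstein_prod_in_tensors[OF X A M]
  note SA = einstein_prod_in_tensors[OF S A M] and TX = einstein_prod_in_tensors[OF T X N]
  note SAX = einstein_prod_in_tensors[OF SA X N] and TXA = einstein_prod_in_tensors[OF TX A M]
  note inject =
    to_fmat_inject[OF einstein_prod_in_tensors[OF AX A M] A, symmetric]
    to_fmat_inject[OF einstein_prod_in_tensors[OF XA X N] X, symmetric]
    to_fmat_inject[OF conj_transpose_in_tensors[OF SAX M] SAX, symmetric]
    to_fmat_inject[OF conj_transpose_in_tensors[OF TXA N] TXA, symmetric]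
  show ?thesis
    unfolding is_weighted_pinv_def weighted_penrose_def d inject
    using X by (simp add: to_fmat_conj_transpose[OF SAX M] to_fmat_conj_transpose[OF TXA N]
        to_fmat_einstein_prod[OF AX A M] to_fmat_einstein_prod[OF A X N]
        to_fmat_einstein_prod[OF XA X N] to_fmat_einstein_prod[OF X A M]
        to_fmat_einstein_prod[OF SA X N] to_fmat_einstein_prod[OF S A M]
        to_fmat_einstein_prod[OF TX A M] to_fmat_einstein_prod[OF T X N])
qed

text \<open>Unique existence in the ring block carries over through \<open>of_fmat\<close>, which
  makes the definite description meaningful.\<close>

lemma weighted_pinv_eq_iff:
  assumes A: "A \<in> tensors (Is @ Js)" and M: "length Is = M" and N: "length Js = N"
    and S: "hermitian_pos_def Is S" and T: "hermitian_pos_def Js T"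
  shows "weighted_pinv M N S T A = X \<longleftrightarrow> is_weighted_pinv M N S T A X"
proof -
  obtain r r' where St: "S \<in> tensors (Is @ Is)" and r: "selfadj_unit (id_fmat Is) r r'"
    and Sr: "to_fmat Is Is S = r * r"
    using hermitian_pos_def_root[OF S] .
  obtain q q' where Tt: "T \<in> tensors (Js @ Js)" and q: "selfadj_unit (id_fmat Js) q q'"
    and Tq: "to_fmat Js Js T = q * q"
    using hermitian_pos_def_root[OF T] .
  have *: "is_weighted_pinv M N S T A X \<longleftrightarrow> X \<in> tensors (Js @ Is) \<and>
      weighted_penrose (r * r) (q * q) (to_fmat Is Js A) (to_fmat Js Is X)" for X
  proof (cases "X \<in> tensors (Js @ Is)")
    case True
    then show ?thesis
      by (simp add: is_weighted_pinv_iff[OF A M N St Tt True] Sr Tq)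
  next
    case False
    then show ?thesis
      using A M by (auto simp: is_weighted_pinv_def tensors_def)
  qed
  have "\<exists>!x. id_fmat Js * x = x \<and> x * id_fmat Is = x \<and>
      weighted_penrose (r * r) (q * q) (to_fmat Is Js A) x"
    by (rule ex1_weighted_penrose[OF r q]) simp_all
  then have "\<exists>!X. is_weighted_pinv M N S T A X"
    unfolding *
    by (metis to_fmat_of_fmat of_fmat_in_tensors to_fmat_inject id_fmat_times_to_fmat to_fmat_times_id_fmat)
  then show ?thesis
    unfolding weighted_pinv_def by (metis the1_equality theI')
qed

theorem theorem4p8:
  fixes M N L :: nat
    and Is Js Ks :: "nat list"
    and \<A> \<B> \<M> \<N> \<L> :: ctensor
  assumes "length Is = M" and "length Js = N" and "length Ks = L"
    and "\<A> \<in> tensors (Is @ Js)" and "\<B> \<in> tensors (Js @ Ks)"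
    and "hermitian_pos_def Is \<M>" and "hermitian_pos_def Js \<N>" and "hermitian_pos_def Ks \<L>"
  shows
    "weighted_pinv M L \<M> \<L> (\<A> \<star>\<^bsub>N\<^esub> \<B>) =
       weighted_pinv N L \<N> \<L> \<B> \<star>\<^bsub>N\<^esub> weighted_pinv M N \<M> \<N> \<A>
     \<longleftrightarrow>
       weighted_conj_transpose N N \<N> \<N>
         (weighted_pinv M N \<M> \<N> \<A> \<star>\<^bsub>M\<^esub> \<A> \<star>\<^bsub>N\<^esub> \<B> \<star>\<^bsub>L\<^esub> weighted_conj_transpose N L \<N> \<L> \<B>) =
       weighted_pinv M N \<M> \<N> \<A> \<star>\<^bsub>M\<^esub> \<A> \<star>\<^bsub>N\<^esub> \<B> \<star>\<^bsub>L\<^esub> weighted_conj_transpose N L \<N> \<L> \<B>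
     \<and>
       weighted_conj_transpose N N \<N> \<N>
         (weighted_conj_transpose M N \<M> \<N> \<A> \<star>\<^bsub>M\<^esub> \<A> \<star>\<^bsub>N\<^esub> \<B> \<star>\<^bsub>L\<^esub> weighted_pinv N L \<N> \<L> \<B>) =
       weighted_conj_transpose M N \<M> \<N> \<A> \<star>\<^bsub>M\<^esub> \<A> \<star>\<^bsub>N\<^esub> \<B> \<star>\<^bsub>L\<^esub> weighted_pinv N L \<N> \<L> \<B>"
proof -
  note M = assms(1) and N = assms(2) and L = assms(3) and A = assms(4) and B = assms(5)
  obtain r r' where \<M>: "\<M> \<in> tensors (Is @ Is)" and r: "selfadj_unit (id_fmat Is) r r'"
    and \<M>r: "to_fmat Is Is \<M> = r * r"
    using hermitian_pos_def_root[OF assms(6)] .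
  obtain q q' where \<N>: "\<N> \<in> tensors (Js @ Js)" and q: "selfadj_unit (id_fmat Js) q q'"
    and \<N>q: "to_fmat Js Js \<N> = q * q"
    using hermitian_pos_def_root[OF assms(7)] .
  obtain l l' where \<L>: "\<L> \<in> tensors (Ks @ Ks)" and l: "selfadj_unit (id_fmat Ks) l l'"
    and \<L>l: "to_fmat Ks Ks \<L> = l * l"
    using hermitian_pos_def_root[OF assms(8)] .
  define X Y where "X = weighted_pinv M N \<M> \<N> \<A>" and "Y = weighted_pinv N L \<N> \<L> \<B>"
  \<comment> \<open>Reflexivity of \<open>X = X\<close> turns the equivalence into the defining
    property of the inverse; the same for \<open>Y\<close>.\<close>
  have Xp: "is_weighted_pinv M N \<M> \<N> \<A> X"
    using weighted_pinv_eq_iff[OF A M N assms(6,7), of X] by (simp add: X_def)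
  have Yp: "is_weighted_pinv N L \<N> \<L> \<B> Y"
    using weighted_pinv_eq_iff[OF B N L assms(7,8), of Y] by (simp add: Y_def)
  have X: "X \<in> tensors (Js @ Is)" and Y: "Y \<in> tensors (Ks @ Js)"
    using Xp Yp A B M N by (auto simp: is_weighted_pinv_def tensors_def)
  define a b x y where "a = to_fmat Is Js \<A>" and "b = to_fmat Js Ks \<B>"
    and "x = to_fmat Js Is X" and "y = to_fmat Ks Js Y"
  have x: "weighted_penrose (r * r) (q * q) a x"
    using Xp is_weighted_pinv_iff[OF A M N \<M> \<N> X] by (simp add: \<M>r \<N>q a_def x_def)
  have y: "weighted_penrose (q * q) (l * l) b y"
    using Yp is_weighted_pinv_iff[OF B N L \<N> \<L> Y] by (simp add: \<L>l \<N>q b_def y_def)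
  note AB = einstein_prod_in_tensors[OF A B N] and YX = einstein_prod_in_tensors[OF Y X N]
  have ab: "to_fmat Is Ks (\<A> \<star>\<^bsub>N\<^esub> \<B>) = a * b" and yx: "to_fmat Ks Is (Y \<star>\<^bsub>N\<^esub> X) = y * x"
    using to_fmat_einstein_prod[OF A B N] to_fmat_einstein_prod[OF Y X N]
    by (simp_all add: a_def b_def x_def y_def)
  note A' = to_fmat_weighted_conj_transpose[OF A M N \<M> \<N> q \<N>q, folded a_def, unfolded \<M>r]
  note B' = to_fmat_weighted_conj_transpose[OF B N L \<N> \<L> l \<L>l, folded b_def, unfolded \<N>q]
  have weighted_selfadj_iff: "weighted_conj_transpose N N \<N> \<N> C = C \<longleftrightarrow> q' * q' * adj c * (q * q) = c"
    if C: "C \<in> tensors (Js @ Js)" and c: "to_fmat Js Js C = c" for C c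
    using to_fmat_weighted_conj_transpose[OF C N N \<N> \<N> q \<N>q, unfolded c \<N>q]
      to_fmat_inject[OF _ C, of "weighted_conj_transpose N N \<N> \<N> C", unfolded c] by simp
  note XA = einstein_prod_in_tensors[OF X A M]
  note XAB = einstein_prod_in_tensors[OF XA B N]
  note XABB' = einstein_prod_in_tensors[OF XAB B'(1) L]
  have xabb': "to_fmat Js Js (X \<star>\<^bsub>M\<^esub> \<A> \<star>\<^bsub>N\<^esub> \<B> \<star>\<^bsub>L\<^esub> weighted_conj_transpose N L \<N> \<L> \<B>) =
      x * a * b * (l' * l' * adj b * (q * q))"
    by (simp add: to_fmat_einstein_prod[OF XAB B'(1) L] to_fmat_einstein_prod[OF XA B N]
        to_fmat_einstein_prod[OF X A M] B'(2) flip: a_def b_def x_def)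
  note A'A = einstein_prod_in_tensors[OF A'(1) A M]
  note A'AB = einstein_prod_in_tensors[OF A'A B N]
  note A'ABY = einstein_prod_in_tensors[OF A'AB Y L]
  have a'aby: "to_fmat Js Js (weighted_conj_transpose M N \<M> \<N> \<A> \<star>\<^bsub>M\<^esub> \<A> \<star>\<^bsub>N\<^esub> \<B> \<star>\<^bsub>L\<^esub> Y) =
      q' * q' * adj a * (r * r) * a * b * y"
    by (simp add: to_fmat_einstein_prod[OF A'AB Y L] to_fmat_einstein_prod[OF A'A B N]
        to_fmat_einstein_prod[OF A'(1) A M] A'(2) flip: a_def b_def y_def)
  have "weighted_pinv M L \<M> \<L> (\<A> \<star>\<^bsub>N\<^esub> \<B>) = Y \<star>\<^bsub>N\<^esub> X \<longleftrightarrow>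
      weighted_penrose (r * r) (l * l) (a * b) (y * x)"
    unfolding weighted_pinv_eq_iff[OF AB M L assms(6,8)] is_weighted_pinv_iff[OF AB M L \<M> \<L> YX]
    by (simp add: \<M>r \<L>l ab yx)
  \<comment> \<open>The open premises say that \<open>a\<close>, \<open>b\<close>, \<open>x\<close>,
    \<open>y\<close> lie in their blocks. They are carried along and discharged at the end by
    unfolding these to images of \<open>to_fmat\<close>.\<close>
  also note weighted_penrose_mult_iff[OF r q l _ _ _ _ _ _ _ _ x y]
  also note weighted_selfadj_iff[OF XABB' xabb', symmetric]
  also note weighted_selfadj_iff[OF A'ABY a'aby, symmetric]
  finally show ?thesis
    unfolding X_def[symmetric] Y_def[symmetric] by (simp add: a_def b_def x_def y_def)
qed

end
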